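(* Let $\mathcal{A}_\alpha := (A, *, \{\,,\,,\,\}, \alpha)$ be a Hom-Bol algebra and let $\beta$ be an endomorphism of $(A, *, \{\,,\,,\,\})$ such that $\beta\alpha = \alpha\beta$. Let $\beta^0 = \mathrm{Id}$ and $\beta^n := \beta\circ\beta^{n-1}$ for $n \geq 1$. Let $n\ge 1$ be an integer and define on $A$ the operations $$x *_\beta y := \beta^n(x*y), \qquad \{x,y,z\}_\beta := \beta^{2n}(\{x,y,z\})$$ for all $x,y,z \in A$. Then $\mathcal{A}_{\beta^n} := (A, *_\beta, \{\,,\,,\,\}_\beta, \beta^n\alpha)$ is a Hom-Bol algebra.
   Context: All vector spaces are over a fixed ground field of characteristic $0$. Binary and ternary operations are bilinear and trilinear maps respectively. $\circlearrowleft_{x,y,z}$ denotes the sum over cyclic permutations of $x,y,z$. A Hom-Bol algebra is a quadruple $(A, *, \{\,,\,,\,\}, \alpha)$ in which $A$ is a vector space, $*$ a binary operation and $\{\,,\,,\,\}$ a ternary operation on $A$, and $\alpha : A \to A$ a linear map such that for all $u,v,w,x,y,z \in A$: (HB1) $\alpha(x*y) = \alpha(x)*\alpha(y)$; (HB2) $\alpha(\{x,y,z\}) = \{\alpha(x),\alpha(y),\alpha(z)\}$; (HB3) $x*y = -y*x$; (HB4) $\{x,y,z\} = -\{y,x,z\}$; (HB5) $\circlearrowleft_{x,y,z}\{x,y,z\} = 0$; (HB6) $\{\alpha(x),\alpha(y),u*v\} = \{x,y,u\}*\alpha^2(v) + \alpha^2(u)*\{x,y,v\} + \{\alpha(u),\alpha(v),x*y\}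 - (\alpha(u)*\alpha(v))*(\alpha(x)*\alpha(y))$; (HB7) $\{\alpha^2(x),\alpha^2(y),\{u,v,w\}\} = \{\{x,y,u\},\alpha^2(v),\alpha^2(w)\} + \{\alpha^2(u),\{x,y,v\},\alpha^2(w)\} + \{\alpha^2(u),\alpha^2(v),\{x,y,w\}\}$. An endomorphism of $(A,*,\{\,,\,,\,\})$ is a linear map $\beta: A\to A$ with $\beta(x*y)=\beta(x)*\beta(y)$ and $\beta(\{x,y,z\})=\{\beta(x),\beta(y),\beta(z)\}$ for all $x,y,z\in A$. *)

theory Defs
  imports Complex_Main
begin

text \<open>The vector space \<open>A\<close> is the type \<open>'a\<close> with scalar multiplication \<open>scale\<close> over the field \<open>'k\<close>.
  \<open>Vector_Spaces.linear\<close> is linearity over this arbitrary field; the unqualified \<open>linear\<close> is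
  linearity over the reals.\<close>

locale binary_ternary_algebra = vector_space scale
  for scale :: "'k::field_char_0 \<Rightarrow> 'a::ab_group_add \<Rightarrow> 'a" +
  fixes mul :: "'a \<Rightarrow> 'a \<Rightarrow> 'a"
    and br :: "'a \<Rightarrow> 'a \<Rightarrow> 'a \<Rightarrow> 'a"
  assumes mul_linear_left: "Vector_Spaces.linear scale scale (\<lambda>x. mul x y)"
    and mul_linear_right: "Vector_Spaces.linear scale scale (\<lambda>y. mul x y)"
    and br_linear_1: "Vector_Spaces.linear scale scale (\<lambda>x. br x y z)"
    and br_linear_2: "Vector_Spaces.linear scale scale (\<lambda>y. br x y z)"
    and br_linear_3: "Vector_Spaces.linear scale scale (\<lambda>z. br x y z)"

locale hom_bol_algebra = binary_ternary_algebra scale mul br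
  for scale :: "'k::field_char_0 \<Rightarrow> 'a::ab_group_add \<Rightarrow> 'a"
    and mul :: "'a \<Rightarrow> 'a \<Rightarrow> 'a"  (infixl \<open>\<star>\<close> 70)
    and br :: "'a \<Rightarrow> 'a \<Rightarrow> 'a \<Rightarrow> 'a" +
  fixes \<alpha> :: "'a \<Rightarrow> 'a"
  assumes alpha_linear: "Vector_Spaces.linear scale scale \<alpha>"
    and HB1: "\<alpha> (x \<star> y) = \<alpha> x \<star> \<alpha> y"
    and HB2: "\<alpha> (br x y z) = br (\<alpha> x) (\<alpha> y) (\<alpha> z)"
    and HB3: "x \<star> y = - (y \<star> x)"
    and HB4: "br x y z = - br y x z"
    and HB5: "br x y z + br y z x + br z x y = 0"
    and HB6: "br (\<alpha> x) (\<alpha> y) (u \<star> v) =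
      br x y u \<star> (\<alpha> ^^ 2) v + (\<alpha> ^^ 2) u \<star> br x y v
      + br (\<alpha> u) (\<alpha> v) (x \<star> y) - (\<alpha> u \<star> \<alpha> v) \<star> (\<alpha> x \<star> \<alpha> y)"
    and HB7: "br ((\<alpha> ^^ 2) x) ((\<alpha> ^^ 2) y) (br u v w) =
      br (br x y u) ((\<alpha> ^^ 2) v) ((\<alpha> ^^ 2) w)
      + br ((\<alpha> ^^ 2) u) (br x y v) ((\<alpha> ^^ 2) w)
      + br ((\<alpha> ^^ 2) u) ((\<alpha> ^^ 2) v) (br x y w)"

locale binary_ternary_endomorphism = binary_ternary_algebra scale mul br
  for scale :: "'k::field_char_0 \<Rightarrow> 'a::ab_group_add \<Rightarrow> 'a"
    and mul :: "'a \<Rightarrow> 'a \<Rightarrow> 'a"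
    and br :: "'a \<Rightarrow> 'a \<Rightarrow> 'a \<Rightarrow> 'a" +
  fixes \<beta> :: "'a \<Rightarrow> 'a"
  assumes endo_linear: "Vector_Spaces.linear scale scale \<beta>"
    and endo_mul: "\<beta> (mul x y) = mul (\<beta> x) (\<beta> y)"
    and endo_br: "\<beta> (br x y z) = br (\<beta> x) (\<beta> y) (\<beta> z)"

end

theory Submission
  imports Defs
begin

text \<open>
  All exponents \<open>n\<close> reduce to one case: \<open>\<beta>\<^sup>n\<close> is again an endomorphism commuting with \<open>\<alpha>\<close>, and
  \<open>\<beta>\<close> raised to \<open>2 * n\<close> is its square, so it suffices to twist by one endomorphism \<open>\<phi>\<close>, replacing
  \<open>x * y\<close>, \<open>{x, y, z}\<close> and \<open>\<alpha>\<close> by \<open>\<phi> (x * y)\<close>, \<open>\<phi>\<^sup>2 {x, y, z}\<close> and \<open>\<phi> \<alpha>\<close>.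

  Give the product and \<open>\<alpha>\<close> weight 1 and the ternary bracket weight 2, and let the depth of a
  variable in a term be the total weight of the operations above it. Within each Hom-Bol identity
  every occurrence of every variable has the same depth \<open>k\<close>: it is 2, 3, 3, 4 for the compatibility
  of \<open>\<alpha>\<close> with the product, of \<open>\<alpha>\<close> with the bracket, of the bracket with the product and of the
  bracket with itself. Twisting inserts one \<open>\<phi>\<close> per unit of weight. Since \<open>\<phi>\<close>
  commutes with all the operations, the inserted factors can be pushed down to the variables, so each
  twisted identity is the original one evaluated at \<open>\<phi>\<^sup>k x\<close>, \<open>\<phi>\<^sup>k y\<close>, and so on. For the
  skew-symmetry and cyclic identities it suffices that \<open>\<phi>\<close> is additive.
\<close>

lemma binary_ternary_endomorphism_funpow:
  assumes "binary_ternary_endomorphism scale mul br \<beta>"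
  shows "binary_ternary_endomorphism scale mul br (\<beta> ^^ n)"
proof -
  interpret binary_ternary_endomorphism scale mul br \<beta> by fact
  show ?thesis
  proof (induction n)
    case 0
    show ?case
      by unfold_locales (simp_all add: linear_id)
  next
    case (Suc n)
    interpret power: binary_ternary_endomorphism scale mul br "\<beta> ^^ n" by (rule Suc.IH)
    have "Vector_Spaces.linear scale scale (\<beta> ^^ Suc n)"
      using Vector_Spaces.linear_compose[OF power.endo_linear endo_linear] by simp
    then show ?case
      by (intro binary_ternary_endomorphism.intro binary_ternary_endomorphism_axioms.intro
            binary_ternary_algebra_axioms)
        (simp_all add: power.endo_mul power.endo_br endo_mul endo_br comp_def)
  qed
qed

text \<open>
  The powers 3 and 4 of \<open>\<phi>\<close> in the instances of \<open>HB6\<close> and \<open>HB7\<close> are the depths of the variables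
  in these identities; pushing \<open>\<phi>\<close> inside the operations and past \<open>\<alpha>\<close> turns the twisted identities
  into those instances.
\<close>

lemma hom_bol_algebra_twist:
  assumes hom_bol: "hom_bol_algebra scale mul br \<alpha>"
    and endo: "binary_ternary_endomorphism scale mul br \<phi>"
    and commute: "\<And>x. \<phi> (\<alpha> x) = \<alpha> (\<phi> x)"
  shows "hom_bol_algebra scale (\<lambda>x y. \<phi> (mul x y)) (\<lambda>x y z. \<phi> (\<phi> (br x y z))) (\<phi> \<circ> \<alpha>)"
proof -
  interpret hom_bol_algebra scale mul br \<alpha> by (rule hom_bol)
  interpret endo: binary_ternary_endomorphism scale mul br \<phi> by (rule endo)
  interpret \<phi>: Vector_Spaces.linear scale scale \<phi> by (rule endo.endo_linear)
  note push = endo.endo_mul endo.endo_br commute \<phi>.add \<phi>.diff HB1 HB2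
  have linear_after: "Vector_Spaces.linear scale scale (\<lambda>x. \<phi> (f x))"
    if "Vector_Spaces.linear scale scale f" for f
    using Vector_Spaces.linear_compose[OF that endo.endo_linear] by (simp add: comp_def)
  show ?thesis
  proof (intro hom_bol_algebra.intro binary_ternary_algebra.intro vector_space_axioms
      binary_ternary_algebra_axioms.intro hom_bol_algebra_axioms.intro)
    fix u v w x y z
    show "Vector_Spaces.linear scale scale (\<lambda>x. \<phi> (mul x y))"
      and "Vector_Spaces.linear scale scale (\<lambda>y. \<phi> (mul x y))"
      and "Vector_Spaces.linear scale scale (\<lambda>x. \<phi> (\<phi> (br x y z)))"
      and "Vector_Spaces.linear scale scale (\<lambda>y. \<phi> (\<phi> (br x y z)))"
      and "Vector_Spaces.linear scale scale (\<lambda>z. \<phi> (\<phi> (br x y z)))"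
      by (intro linear_after mul_linear_left mul_linear_right br_linear_1 br_linear_2 br_linear_3)+
    show "Vector_Spaces.linear scale scale (\<phi> \<circ> \<alpha>)"
      by (rule Vector_Spaces.linear_compose[OF alpha_linear endo.endo_linear])
    show "(\<phi> \<circ> \<alpha>) (\<phi> (mul x y)) = \<phi> (mul ((\<phi> \<circ> \<alpha>) x) ((\<phi> \<circ> \<alpha>) y))"
      by (simp add: push)
    show "(\<phi> \<circ> \<alpha>) (\<phi> (\<phi> (br x y z)))
        = \<phi> (\<phi> (br ((\<phi> \<circ> \<alpha>) x) ((\<phi> \<circ> \<alpha>) y) ((\<phi> \<circ> \<alpha>) z)))"
      by (simp add: push)
    show "\<phi> (mul x y) = - \<phi> (mul y x)"
      by (subst HB3) (rule \<phi>.neg)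
    show "\<phi> (\<phi> (br x y z)) = - \<phi> (\<phi> (br y x z))"
      by (subst HB4) (simp only: \<phi>.neg)
    show "\<phi> (\<phi> (br x y z)) + \<phi> (\<phi> (br y z x)) + \<phi> (\<phi> (br z x y)) = 0"
      by (simp only: \<phi>.add[symmetric] HB5 \<phi>.zero)
    show "\<phi> (\<phi> (br ((\<phi> \<circ> \<alpha>) x) ((\<phi> \<circ> \<alpha>) y) (\<phi> (mul u v))))
        = \<phi> (mul (\<phi> (\<phi> (br x y u))) (((\<phi> \<circ> \<alpha>) ^^ 2) v))
          + \<phi> (mul (((\<phi> \<circ> \<alpha>) ^^ 2) u) (\<phi> (\<phi> (br x y v))))
          + \<phi> (\<phi> (br ((\<phi> \<circ> \<alpha>) u) ((\<phi> \<circ> \<alpha>) v) (\<phi> (mul x y))))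
          - \<phi> (mul (\<phi> (mul ((\<phi> \<circ> \<alpha>) u) ((\<phi> \<circ> \<alpha>) v)))
                 (\<phi> (mul ((\<phi> \<circ> \<alpha>) x) ((\<phi> \<circ> \<alpha>) y))))"
      using HB6[of "\<phi> (\<phi> (\<phi> x))" "\<phi> (\<phi> (\<phi> y))" "\<phi> (\<phi> (\<phi> u))" "\<phi> (\<phi> (\<phi> v))"]
      by (simp add: push numeral_2_eq_2)
    show "\<phi> (\<phi> (br (((\<phi> \<circ> \<alpha>) ^^ 2) x) (((\<phi> \<circ> \<alpha>) ^^ 2) y) (\<phi> (\<phi> (br u v w)))))
        = \<phi> (\<phi> (br (\<phi> (\<phi> (br x y u))) (((\<phi> \<circ> \<alpha>) ^^ 2) v) (((\<phi> \<circ> \<alpha>) ^^ 2) w)))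
          + \<phi> (\<phi> (br (((\<phi> \<circ> \<alpha>) ^^ 2) u) (\<phi> (\<phi> (br x y v))) (((\<phi> \<circ> \<alpha>) ^^ 2) w)))
          + \<phi> (\<phi> (br (((\<phi> \<circ> \<alpha>) ^^ 2) u) (((\<phi> \<circ> \<alpha>) ^^ 2) v) (\<phi> (\<phi> (br x y w)))))"
      using HB7[of "\<phi> (\<phi> (\<phi> (\<phi> x)))" "\<phi> (\<phi> (\<phi> (\<phi> y)))" "\<phi> (\<phi> (\<phi> (\<phi> u)))"
          "\<phi> (\<phi> (\<phi> (\<phi> v)))" "\<phi> (\<phi> (\<phi> (\<phi> w)))"]
      by (simp add: push numeral_2_eq_2)
  qed
qed

theorem theorem3p2:
  fixes scale :: "'k::field_char_0 \<Rightarrow> 'a::ab_group_add \<Rightarrow> 'a"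
    and mul :: "'a \<Rightarrow> 'a \<Rightarrow> 'a"
    and br :: "'a \<Rightarrow> 'a \<Rightarrow> 'a \<Rightarrow> 'a"
    and \<alpha> \<beta> :: "'a \<Rightarrow> 'a"
    and n :: nat
  assumes "hom_bol_algebra scale mul br \<alpha>"
    and "binary_ternary_endomorphism scale mul br \<beta>"
    and "\<beta> \<circ> \<alpha> = \<alpha> \<circ> \<beta>"
    and "n \<ge> 1"
  shows "hom_bol_algebra scale
    (\<lambda>x y. (\<beta> ^^ n) (mul x y))
    (\<lambda>x y z. (\<beta> ^^ (2 * n)) (br x y z))
    ((\<beta> ^^ n) \<circ> \<alpha>)"
proof -
  have "(\<beta> ^^ n) (\<alpha> x) = \<alpha> ((\<beta> ^^ n) x)" for x
    using assms(3) by (induction n) (simp_all add: fun_eq_iff)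
  then show ?thesis
    using hom_bol_algebra_twist[OF assms(1) binary_ternary_endomorphism_funpow[OF assms(2)]]
    by (simp add: mult_2 funpow_add)
qed

end
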